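(* Let $C>0$ and let $(f_d)_{d\ge1}$ be a sequence of random $C$-Lipschitz functions $f_d\colon\mathbb{R}\to\mathbb{R}_{\ge0}$ (with $\mathbb{P}_d$ the law governing $f_d$) such that $f_d(x)dx\in\mathcal{M}_{<\infty}(\mathbb{R})$. Suppose that (a) for every $\epsilon>0$ there exists $N>0$ such that $\lim_{d\to\infty}\mathbb{P}_d\big(\|f_d\|_{L^\infty(\mathbb{R}\setminus[-N,N])}>\epsilon\big)=0$; (b) there exists a measure $\mu\in\mathcal{M}_{<\infty}(\mathbb{R})$, uniquely determined by its moments, such that for every $\epsilon>0$ and $\ell\in\mathbb{Z}_{\ge0}$, $$\lim_{d\to\infty}\mathbb{P}_d\Big(\Big|\int_{\mathbb{R}}x^\ell f_d(x)dx-M_\ell(\mu)\Big|>\epsilon\Big)=0.$$ Then $(f_d)_{d\ge1}$ has a deterministic limit $f\colon\mathbb{R}\to\mathbb{R}_{\ge0}$ in the supremum norm, in probability: $$\forall\epsilon>0,\qquad\lim_{d\to\infty}\mathbb{P}_d\big(\|f_d-f\|_\infty>\epsilon\big)=0.$$ The function $f$ is $C$-Lipschitz and is a density of the measure $\mu$.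
   Context: $\mathcal{M}_{<\infty}(\mathbb{R})$ is the set of positive finite measures on $\mathbb{R}$ having finite moments of all orders. $M_\ell(\mu):=\int_{\mathbb{R}}x^\ell d\mu(x)$ is the $\ell$-th moment. "Uniquely determined by its moments" means that no other measure in $\mathcal{M}_{<\infty}(\mathbb{R})$ has the same moments. *)

theory Defs
  imports "HOL-Probability.Probability"
begin

definition moment :: "nat \<Rightarrow> real measure \<Rightarrow> real" where
  "moment l \<mu> = (LINT x|\<mu>. x ^ l)"

definition finite_moment_measures :: "real measure set" where
  "finite_moment_measures =
     {\<mu>. finite_borel_measure \<mu> \<and> (\<forall>l::nat. integrable \<mu> (\<lambda>x. x ^ l))}"

definition determined_by_moments :: "real measure \<Rightarrow> bool" where
  "determined_by_moments \<mu> \<longleftrightarrow>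
     (\<forall>\<nu>\<in>finite_moment_measures. (\<forall>l. moment l \<nu> = moment l \<mu>) \<longrightarrow> \<nu> = \<mu>)"

text \<open>
  Both norms take values in the extended reals, so that they are meaningful (and possibly
  \<open>\<infinity>\<close>) for unbounded functions.
\<close>

definition sup_norm :: "(real \<Rightarrow> real) \<Rightarrow> ereal" where
  "sup_norm g = (SUP x. ereal \<bar>g x\<bar>)"

definition Linf_norm_on :: "real set \<Rightarrow> (real \<Rightarrow> real) \<Rightarrow> ereal" where
  "Linf_norm_on A g = esssup (restrict_space lborel A) (\<lambda>x. ereal \<bar>g x\<bar>)"

text \<open>
  A random function is a family of random variables indexed by the argument \<open>x\<close>. On continuous
  functions the evaluations generate the Borel sigma-algebra of locally uniform convergence, so
  for continuous paths this is the usual notion, and the norms and moments of the paths used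
  here are then measurable. The sample spaces \<open>P d\<close> may differ for different \<open>d\<close>.
\<close>

definition random_lipschitz_function ::
  "real \<Rightarrow> 'a measure \<Rightarrow> ('a \<Rightarrow> real \<Rightarrow> real) \<Rightarrow> bool" where
  "random_lipschitz_function C M g \<longleftrightarrow>
     prob_space M \<and>
     (\<forall>x. (\<lambda>\<omega>. g \<omega> x) \<in> borel_measurable M) \<and>
     (\<forall>\<omega>\<in>space M. C-lipschitz_on UNIV (g \<omega>) \<and> (\<forall>x. 0 \<le> g \<omega> x))"

end

theory Submission
  imports Defs "HOL-Complex_Analysis.Great_Picard"
begin

text \<open>
  A nonnegative \<open>C\<close>-Lipschitz function of height \<open>a\<close> at \<open>x\<close> stays above \<open>a / 2\<close> on an interval of
  length \<open>a / (2 C)\<close> pointing away from the origin, so its even moments bound \<open>x\<^sup>2\<^sup>k a\<^sup>2\<close>. Along a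
  sequence with converging moments every \<open>x\<^sup>l h\<^sub>n(x)\<close> is therefore dominated by a multiple of
  \<open>1 / (1 + x\<^sup>2)\<close>. Hence some subsequence converges uniformly, and by dominated convergence its limit
  is a density with the moments of \<open>\<mu>\<close>, that is, a density of \<open>\<mu>\<close>. As \<open>\<mu>\<close> has only one
  continuous density \<open>g\<close>, for each \<open>\<epsilon>\<close> there are finitely many moment conditions which force
  \<open>\<bar>h - g\<bar> < \<epsilon>\<close>, and these fail with probability tending to zero. The existence of \<open>g\<close> follows from
  the same compactness, since for every finite set of moment conditions some sample path meets them.
\<close>

section \<open>Pointwise decay of Lipschitz functions from moment bounds\<close>

lemma lipschitz_peak_bound:
  fixes h :: "real \<Rightarrow> real"
  assumes "C > 0" and lip: "C-lipschitz_on UNIV h" and nonneg: "\<And>x. 0 \<le> h x"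
    and int: "integrable lborel (\<lambda>x. x ^ (2 * k) * h x)"
  shows "x ^ (2 * k) * (h x)\<^sup>2 \<le> 4 * C * (LINT t|lborel. t ^ (2 * k) * h t)"
proof -
  define s where "s = h x / (2 * C)"
  \<comment> \<open>Extending away from 0 ensures \<open>\<bar>x\<bar> \<le> \<bar>t\<bar>\<close>
    for \<open>t\<close> in \<open>I\<close>, so the even power does not drop below its value at
    \<open>x\<close>.\<close>
  define I where "I = (if x \<ge> 0 then {x..x + s} else {x - s..x})"
  have s0: "s \<ge> 0" using nonneg[of x] \<open>C > 0\<close> by (simp add: s_def)
  have meas: "measure lborel I = s" "emeasure lborel I < \<infinity>" "I \<in> sets lborel"
    using s0 by (auto simp: I_def)
  have pt: "indicator I t * (x ^ (2 * k) * (h x / 2)) \<le> t ^ (2 * k) * h t" for t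
  proof (cases "t \<in> I")
    case True
    then have "\<bar>x\<bar> \<le> \<bar>t\<bar>" and d: "\<bar>x - t\<bar> \<le> s"
      by (auto simp: I_def split: if_splits)
    then have p: "x ^ (2 * k) \<le> t ^ (2 * k)"
      using power_mono[of "\<bar>x\<bar>" "\<bar>t\<bar>" "2 * k"] by (simp add: power_even_abs)
    have "\<bar>h x - h t\<bar> \<le> C * \<bar>x - t\<bar>"
      using lipschitz_onD[OF lip, of x t] by (simp add: dist_real_def)
    also have "\<dots> \<le> C * s" using d \<open>C > 0\<close> by simp
    also have "\<dots> = h x / 2" using \<open>C > 0\<close> by (simp add: s_def)
    finally have "h x / 2 \<le> h t" by linarith
    then have "x ^ (2 * k) * (h x / 2) \<le> t ^ (2 * k) * h t"
      using p nonneg[of x] by (intro mult_mono) (auto simp: zero_le_even_power)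
    then show ?thesis using True by simp
  next
    case False
    then show ?thesis using nonneg[of t] by (simp add: zero_le_even_power)
  qed
  have "s * (x ^ (2 * k) * (h x / 2)) = (LINT t|lborel. indicator I t * (x ^ (2 * k) * (h x / 2)))"
    using meas by simp
  also have "\<dots> \<le> (LINT t|lborel. t ^ (2 * k) * h t)"
    using meas by (intro integral_mono int pt integrable_mult_left integrable_real_indicator) auto
  finally show ?thesis using \<open>C > 0\<close> by (simp add: s_def field_simps power2_eq_square)
qed

text \<open>Convergent moments are bounded in \<open>n\<close>, which makes the peak bound uniform.
  The weight \<open>1 + x\<^sup>2\<close> is chosen because its inverse is integrable and vanishes
  at infinity: the bound serves both as a dominating function and as tail control.\<close>

lemma lipschitz_moment_decay:
  fixes h :: "nat \<Rightarrow> real \<Rightarrow> real" and l :: nat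
  assumes "C > 0" and lip: "\<And>n. C-lipschitz_on UNIV (h n)" and nonneg: "\<And>n x. 0 \<le> h n x"
    and int: "\<And>n l. integrable lborel (\<lambda>x. x ^ l * h n x)"
    and conv: "\<And>l. convergent (\<lambda>n. LINT x|lborel. x ^ l * h n x)"
  obtains K where "K \<ge> 0" "\<And>n x. \<bar>x ^ l * h n x\<bar> \<le> K * inverse (1 + x\<^sup>2)"
proof -
  define M where "M l n = (LINT x|lborel. x ^ l * h n x)" for l n
  \<comment> \<open>The coefficients 1, 2, 1 come from expanding
    \<open>(1 + x\<^sup>2)\<^sup>2\<close>; the factor \<open>4 * C\<close> comes from the peak
    bound, applied to each of the three even powers.\<close>
  define S where "S n = 4 * C * (M (2 * l) n + 2 * M (2 * (l + 1)) n + M (2 * (l + 2)) n)" for n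
  have "convergent S"
    unfolding S_def M_def using conv
    by (intro convergent_mult convergent_add convergent_const)
  then obtain B where B: "B > 0" "\<And>n. \<bar>S n\<bar> \<le> B"
    by (metis convergent_imp_Bseq BseqE real_norm_def)
  show ?thesis
  proof
    show "sqrt B \<ge> 0" using B by simp
    fix n x
    note pk = lipschitz_peak_bound[OF \<open>C > 0\<close> lip[of n] nonneg int, where x = x]
    have "(\<bar>x ^ l * h n x\<bar> * (1 + x\<^sup>2))\<^sup>2
        = x ^ (2 * l) * (h n x)\<^sup>2 + 2 * (x ^ (2 * (l + 1)) * (h n x)\<^sup>2) + x ^ (2 * (l + 2)) * (h n x)\<^sup>2"
    proof -
      have "x ^ (2 * (l + j)) = x ^ l * x ^ l * x ^ (2 * j)" for j
        by (simp add: mult_2 power_add)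
      from this[of 0] this[of 1] this[of 2] show ?thesis
        unfolding power_mult_distrib power2_abs
        by (simp add: power2_eq_square power4_eq_xxxx algebra_simps)
    qed
    also have "\<dots> \<le> S n"
      using pk[of l] pk[of "l + 1"] pk[of "l + 2"] by (simp add: S_def M_def algebra_simps)
    also have "\<dots> \<le> B" using B(2)[of n] by linarith
    finally have "\<bar>x ^ l * h n x\<bar> * (1 + x\<^sup>2) \<le> sqrt B" by (rule real_le_rsqrt)
    moreover have "0 < 1 + x\<^sup>2" by (simp add: add_pos_nonneg)
    ultimately show "\<bar>x ^ l * h n x\<bar> \<le> sqrt B * inverse (1 + x\<^sup>2)"
      by (simp add: field_simps)
  qed
qed

section \<open>Compactness of families of Lipschitz functions on the line\<close>

text \<open>The argument of Arzela and Ascoli: diagonal extraction gives convergence at the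
  rationals, and the common Lipschitz constant carries the Cauchy property over to every real
  point.\<close>

lemma lipschitz_pointwise_subsequence:
  fixes h :: "nat \<Rightarrow> real \<Rightarrow> real"
  assumes lip: "\<And>n. C-lipschitz_on UNIV (h n)" and bound: "\<And>n x. \<bar>h n x\<bar> \<le> B"
  obtains g r where "strict_mono (r :: nat \<Rightarrow> nat)" "C-lipschitz_on UNIV g"
    "\<And>x. (\<lambda>n. h (r n) x) \<longlonglongrightarrow> g x"
proof -
  have C0: "C \<ge> 0" using lip[of 0] lipschitz_on_nonneg by blast
  obtain r :: "nat \<Rightarrow> nat" where r: "strict_mono r"
      and conv: "\<And>q. q \<in> \<rat> \<Longrightarrow> \<exists>l. (\<lambda>n. h (r n) q) \<longlonglongrightarrow> l"
    by (rule function_convergent_subsequence[OF countable_rat, of h B]) (auto simp: bound)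
  have dist_h: "\<bar>h n x - h n y\<bar> \<le> C * \<bar>x - y\<bar>" for n x y
    using lipschitz_onD[OF lip, of x y] by (simp add: dist_real_def)
  have cauchy: "Cauchy (\<lambda>n. h (r n) x)" for x
  proof (rule CauchyI)
    fix e :: real assume "e > 0"
    \<comment> \<open>Dividing by \<open>C + 1\<close> covers \<open>C = 0\<close>. Two moves from
      \<open>x\<close> to \<open>q\<close> cost \<open>e / 4\<close> each, leaving
      \<open>e / 2\<close> for the comparison at \<open>q\<close>.\<close>
    define d where "d = e / (4 * (C + 1))"
    have d: "d > 0" "C * d \<le> e / 4"
      using C0 \<open>e > 0\<close> by (auto simp: d_def field_simps)
    obtain q where q: "q \<in> \<rat>" "\<bar>x - q\<bar> < d"
      using Rats_dense_in_real[of x "x + d"] d by (force simp: abs_if)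
    have "C * \<bar>x - q\<bar> \<le> C * d" using q C0 by (intro mult_left_mono) auto
    then have near: "\<bar>h n x - h n q\<bar> \<le> e / 4" for n
      using dist_h[of n x q] d(2) by linarith
    have "Cauchy (\<lambda>n. h (r n) q)" using conv[OF q(1)] LIMSEQ_imp_Cauchy by blast
    then obtain N where N: "\<And>m n. m \<ge> N \<Longrightarrow> n \<ge> N \<Longrightarrow> \<bar>h (r m) q - h (r n) q\<bar> < e / 2"
      using \<open>e > 0\<close> by (metis CauchyD half_gt_zero real_norm_def)
    show "\<exists>N. \<forall>m\<ge>N. \<forall>n\<ge>N. norm (h (r m) x - h (r n) x) < e"
    proof (intro exI[of _ N] allI impI)
      fix m n assume "N \<le> m" "N \<le> n"
      then show "norm (h (r m) x - h (r n) x) < e"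
        using N[of m n] near[of "r m"] near[of "r n"] unfolding real_norm_def by linarith
    qed
  qed
  define g where "g x = lim (\<lambda>n. h (r n) x)" for x
  have g: "(\<lambda>n. h (r n) x) \<longlonglongrightarrow> g x" for x
    unfolding g_def using cauchy
    by (intro convergent_LIMSEQ_iff[THEN iffD1] Cauchy_convergent)
  have "C-lipschitz_on UNIV g"
  proof (rule lipschitz_onI)
    fix x y :: real
    have "(\<lambda>n. \<bar>h (r n) x - h (r n) y\<bar>) \<longlonglongrightarrow> \<bar>g x - g y\<bar>"
      by (intro tendsto_intros g)
    then have "\<bar>g x - g y\<bar> \<le> C * \<bar>x - y\<bar>"
      using dist_h by (intro LIMSEQ_le_const2) blast+
    then show "dist (g x) (g y) \<le> C * dist x y"
      by (simp add: dist_real_def)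
  qed (rule C0)
  then show thesis using that r g by blast
qed

text \<open>On a compact interval, a finite net and the common Lipschitz constant turn pointwise
  into uniform convergence. Outside it, the common decay keeps both functions small.\<close>

lemma lipschitz_uniform_limit:
  fixes h :: "nat \<Rightarrow> real \<Rightarrow> real"
  assumes lip: "\<And>n. C-lipschitz_on UNIV (h n)" "C-lipschitz_on UNIV g"
    and lim: "\<And>x. (\<lambda>n. h n x) \<longlonglongrightarrow> g x"
    and nonneg: "\<And>n x. 0 \<le> h n x" and decay: "\<And>n x. h n x \<le> K * inverse (1 + x\<^sup>2)"
  shows "uniform_limit UNIV h g sequentially"
proof (rule uniform_limitI)
  fix e :: real assume "e > 0"
  have C0: "C \<ge> 0" using lip(2) lipschitz_on_nonneg by blast
  have K0: "K \<ge> 0" using nonneg[of 0 0] decay[of 0 0] by simp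
  \<comment> \<open>Since \<open>R \<ge> 1\<close>, \<open>\<bar>x\<bar> \<ge> R\<close> gives
    \<open>x\<^sup>2 \<ge> R \<ge> 2 * K / e\<close>, so the decay bound is at most
    \<open>e / 2\<close> there.\<close>
  define R where "R = 1 + 2 * K / e"
  define d where "d = e / (4 * (C + 1))"
  have d: "d > 0" "C * d \<le> e / 4" using C0 \<open>e > 0\<close> by (auto simp: d_def field_simps)
  obtain T where T: "finite T" "{-R..R} \<subseteq> (\<Union>t\<in>T. ball t d)"
    using seq_compact_imp_totally_bounded[of "{-R..R}"] d(1) compact_imp_seq_compact[OF compact_Icc]
    by meson
  have "\<forall>\<^sub>F n in sequentially. \<forall>t\<in>T. dist (h n t) (g t) < e / 4"
    using T(1) lim \<open>e > 0\<close> by (intro eventually_ball_finite ballI tendstoD) auto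
  then show "\<forall>\<^sub>F n in sequentially. \<forall>x\<in>UNIV. dist (h n x) (g x) < e"
  proof (eventually_elim, intro ballI)
    fix n x assume n: "\<forall>t\<in>T. dist (h n t) (g t) < e / 4"
    show "dist (h n x) (g x) < e"
    proof (cases "x \<in> {-R..R}")
      case True
      then obtain t where t: "t \<in> T" "dist t x < d" using T(2) by auto
      have "C * dist t x \<le> C * d" using t C0 by (intro mult_left_mono) auto
      then have "dist (h n t) (h n x) \<le> e / 4" "dist (g t) (g x) \<le> e / 4"
        using lipschitz_onD[OF lip(1)[of n], of t x] lipschitz_onD[OF lip(2), of t x] d(2) by auto
      moreover have "dist (h n t) (g t) < e / 4" using n t by blast
      ultimately show ?thesis using \<open>e > 0\<close> unfolding dist_real_def by linarith
    next
      case False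
      then have "R \<le> \<bar>x\<bar>" by auto
      moreover have "1 \<le> R" using K0 \<open>e > 0\<close> by (simp add: R_def)
      ultimately have "R * 1 \<le> \<bar>x\<bar> * \<bar>x\<bar>" by (intro mult_mono) auto
      then have "2 * K / e \<le> x\<^sup>2" by (simp add: R_def power2_eq_square)
      then have "2 * K \<le> e * x\<^sup>2" using \<open>e > 0\<close> by (simp add: field_simps)
      moreover have "0 < 1 + x\<^sup>2" by (simp add: add_pos_nonneg)
      ultimately have small: "K * inverse (1 + x\<^sup>2) \<le> e / 2"
        using \<open>e > 0\<close> by (simp add: field_simps)
      have "g x \<le> K * inverse (1 + x\<^sup>2)" "0 \<le> g x"
        using lim[of x] decay nonneg by (auto intro: LIMSEQ_le_const LIMSEQ_le_const2)
      with small decay[of n x] nonneg[of n x] \<open>e > 0\<close> show ?thesis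
        by (simp add: dist_real_def abs_less_iff)
    qed
  qed
qed

section \<open>Continuous densities and their moments\<close>

text \<open>Two densities of one measure agree almost everywhere. By continuity the set of agreement
  is closed, and a closed set of full Lebesgue measure is the whole line.\<close>

lemma continuous_density_unique:
  fixes g g' :: "real \<Rightarrow> real"
  assumes cont: "continuous_on UNIV g" "continuous_on UNIV g'"
    and nonneg: "\<And>x. 0 \<le> g x" "\<And>x. 0 \<le> g' x"
    and eq: "density lborel (\<lambda>x. ennreal (g x)) = density lborel (\<lambda>x. ennreal (g' x))"
  shows "g = g'"
proof
  fix x
  have meas: "g \<in> borel_measurable borel" "g' \<in> borel_measurable borel"
    using cont by (auto intro: borel_measurable_continuous_onI)
  have "AE x in lborel. ennreal (g x) = ennreal (g' x)"
    using meas by (intro sigma_finite_measure.density_unique[OF sigma_finite_lborel _ _ eq]) auto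
  then have "AE x in lborel. x \<in> {x. g x = g' x}"
    using nonneg by simp
  then have "AE x in lebesgue. x \<in> {x. g x = g' x}"
    by (rule AE_completion)
  moreover have "closed {x. g x = g' x}"
    using cont by (rule closed_Collect_eq)
  ultimately show "g x = g' x"
    using mem_closed_if_AE_lebesgue by blast
qed

lemma density_finite_moment_measures_iff:
  fixes g :: "real \<Rightarrow> real"
  assumes [measurable]: "g \<in> borel_measurable borel" and nonneg: "\<And>x. 0 \<le> g x"
  shows "density lborel (\<lambda>x. ennreal (g x)) \<in> finite_moment_measures
    \<longleftrightarrow> (\<forall>l. integrable lborel (\<lambda>x. x ^ l * g x))"
proof -
  let ?\<nu> = "density lborel (\<lambda>x. ennreal (g x))"
  have int: "integrable ?\<nu> (\<lambda>x. x ^ l) \<longleftrightarrow> integrable lborel (\<lambda>x. x ^ l * g x)" for l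
    using nonneg by (subst integrable_density) (auto simp: mult.commute)
  \<comment> \<open>Finiteness of the total mass is the case \<open>l = 0\<close> of the
    integrability condition.\<close>
  have "finite_borel_measure ?\<nu>" if "integrable lborel (\<lambda>x. x ^ 0 * g x)"
  proof -
    have "emeasure ?\<nu> (space ?\<nu>) = ennreal (LINT x|lborel. g x)"
      using that nonneg by (simp add: emeasure_density nn_integral_eq_integral)
    then have "finite_measure ?\<nu>" by (intro finite_measureI) simp
    then show ?thesis
      by (simp add: finite_borel_measure_def finite_borel_measure_axioms_def)
  qed
  then show ?thesis using int unfolding finite_moment_measures_def by blast
qed

lemma moment_density:
  fixes g :: "real \<Rightarrow> real"
  assumes "g \<in> borel_measurable borel" "\<And>x. 0 \<le> g x"
  shows "moment l (density lborel (\<lambda>x. ennreal (g x))) = (LINT x|lborel. x ^ l * g x)"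
  unfolding moment_def using assms by (subst integral_density) (auto simp: mult.commute)

section \<open>Compactness under convergence of moments\<close>

text \<open>The decay constants act twice: \<open>K 0\<close> bounds the functions and makes the
  convergence uniform, while \<open>K l\<close> dominates \<open>x ^ l * h n x\<close> so that the
  moments pass to the limit. Determinacy then identifies the limit measure, and the density of
  \<open>\<mu>\<close> is obtained rather than assumed.\<close>

lemma lipschitz_moment_compactness:
  fixes h :: "nat \<Rightarrow> real \<Rightarrow> real"
  assumes "C > 0" and lip: "\<And>n. C-lipschitz_on UNIV (h n)" and nonneg: "\<And>n x. 0 \<le> h n x"
    and int: "\<And>n l. integrable lborel (\<lambda>x. x ^ l * h n x)"
    and det: "determined_by_moments \<mu>"
    and conv: "\<And>l. (\<lambda>n. LINT x|lborel. x ^ l * h n x) \<longlonglongrightarrow> moment l \<mu>"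
  obtains g r where "strict_mono (r :: nat \<Rightarrow> nat)" "C-lipschitz_on UNIV g" "\<And>x. 0 \<le> g x"
    "\<mu> = density lborel (\<lambda>x. ennreal (g x))" "uniform_limit UNIV (\<lambda>n. h (r n)) g sequentially"
proof -
  have "\<exists>K\<ge>0. \<forall>n x. \<bar>x ^ l * h n x\<bar> \<le> K * inverse (1 + x\<^sup>2)" for l
    using convergentI[OF conv]
    by (rule lipschitz_moment_decay[OF \<open>C > 0\<close> lip nonneg int, where l = l]) blast
  then obtain K where K: "\<And>l. K l \<ge> 0"
      "\<And>l n x. \<bar>x ^ l * h n x\<bar> \<le> K l * inverse (1 + x\<^sup>2)"
    by metis
  have "h n x \<le> K 0" for n x
  proof -
    have "inverse (1 + x\<^sup>2) \<le> 1" by (intro inverse_le_1_iff[THEN iffD2]) simp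
    then have "K 0 * inverse (1 + x\<^sup>2) \<le> K 0" using K(1)[of 0] by (intro mult_left_le) auto
    then show ?thesis using K(2)[of x 0 n] by simp
  qed
  then obtain g r where r: "strict_mono (r :: nat \<Rightarrow> nat)" and g: "C-lipschitz_on UNIV g"
      and lim: "\<And>x. (\<lambda>n. h (r n) x) \<longlonglongrightarrow> g x"
    using lipschitz_pointwise_subsequence[of C h "K 0"] lip nonneg by (metis abs_of_nonneg)
  have g0: "0 \<le> g x" for x
    using lim[of x] nonneg by (auto intro: LIMSEQ_le_const)
  have [measurable]: "g \<in> borel_measurable borel" "h n \<in> borel_measurable borel" for n
    using g lip by (auto intro!: borel_measurable_continuous_onI lipschitz_on_continuous_on)
  have inv: "integrable lborel (\<lambda>x::real. inverse (1 + x\<^sup>2))"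
    using integrable_inverse_1_plus_square by (simp add: set_integrable_def)
  have gint: "integrable lborel (\<lambda>x. x ^ l * g x)"
    and glim: "(\<lambda>n. LINT x|lborel. x ^ l * h (r n) x) \<longlonglongrightarrow> (LINT x|lborel. x ^ l * g x)" for l
  proof -
    show "integrable lborel (\<lambda>x. x ^ l * g x)"
      by (rule integrable_dominated_convergence[where s = "\<lambda>n x. x ^ l * h (r n) x"
            and w = "\<lambda>x. K l * inverse (1 + x\<^sup>2)"])
         (use K inv lim in \<open>auto intro!: tendsto_intros\<close>)
    show "(\<lambda>n. LINT x|lborel. x ^ l * h (r n) x) \<longlonglongrightarrow> (LINT x|lborel. x ^ l * g x)"
      by (rule integral_dominated_convergence[where w = "\<lambda>x. K l * inverse (1 + x\<^sup>2)"])
         (use K inv lim in \<open>auto intro!: tendsto_intros\<close>)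
  qed
  have "moment l (density lborel (\<lambda>x. ennreal (g x))) = moment l \<mu>" for l
    using LIMSEQ_unique[OF glim LIMSEQ_subseq_LIMSEQ[OF conv r, unfolded o_def]] g0
    by (simp add: moment_density)
  moreover have "density lborel (\<lambda>x. ennreal (g x)) \<in> finite_moment_measures"
    using gint g0 by (subst density_finite_moment_measures_iff) auto
  ultimately have "\<mu> = density lborel (\<lambda>x. ennreal (g x))"
    using det unfolding determined_by_moments_def by metis
  moreover have "uniform_limit UNIV (\<lambda>n. h (r n)) g sequentially"
    using K(2)[of _ 0] nonneg by (intro lipschitz_uniform_limit[OF lip g lim, of "K 0"]) auto
  ultimately show thesis using that r g g0 by blast
qed

section \<open>Joint measurability of random continuous functions\<close>

text \<open>Rounding the argument down to the grid of step \<open>1 / Suc n\<close> leaves countably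
  many sections, each measurable, and continuity of the paths gives the pointwise limit. Joint
  measurability is what makes the moment integrals random variables.\<close>

lemma borel_measurable_caratheodory:
  fixes f :: "'a \<Rightarrow> real \<Rightarrow> real"
  assumes meas: "\<And>x. (\<lambda>\<omega>. f \<omega> x) \<in> borel_measurable M"
    and cont: "\<And>\<omega>. \<omega> \<in> space M \<Longrightarrow> continuous_on UNIV (f \<omega>)"
  shows "(\<lambda>(\<omega>, x). f \<omega> x) \<in> borel_measurable (M \<Otimes>\<^sub>M borel)"
proof (rule borel_measurable_LIMSEQ_real)
  fix n :: nat
  have "(\<lambda>z. f (fst z) (real_of_int \<lfloor>real (Suc n) * snd z\<rfloor> / real (Suc n))) \<in> borel_measurable (M \<Otimes>\<^sub>M borel)"
    by (rule measurable_compose_countable[where f = "\<lambda>i z. f (fst z) (real_of_int i / real (Suc n))"])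
       (use meas in measurable)
  then show "(\<lambda>(\<omega>, x). f \<omega> (real_of_int \<lfloor>real (Suc n) * x\<rfloor> / real (Suc n))) \<in> borel_measurable (M \<Otimes>\<^sub>M borel)"
    by (simp add: case_prod_beta)
next
  fix z :: "'a \<times> real" assume "z \<in> space (M \<Otimes>\<^sub>M borel)"
  then obtain \<omega> x where z: "z = (\<omega>, x)" "\<omega> \<in> space M" by (auto simp: space_pair_measure)
  have "(\<lambda>n. real_of_int \<lfloor>real (Suc n) * x\<rfloor> / real (Suc n)) \<longlonglongrightarrow> x"
  proof (rule tendsto_sandwich)
    show "\<forall>\<^sub>F n in sequentially. x - 1 / real (Suc n) \<le> real_of_int \<lfloor>real (Suc n) * x\<rfloor> / real (Suc n)"
    proof (rule always_eventually, rule allI)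
      fix n
      have "real (Suc n) * x - 1 \<le> real_of_int \<lfloor>real (Suc n) * x\<rfloor>" by linarith
      then have "(real (Suc n) * x - 1) / real (Suc n) \<le> real_of_int \<lfloor>real (Suc n) * x\<rfloor> / real (Suc n)"
        by (rule divide_right_mono) simp
      then show "x - 1 / real (Suc n) \<le> real_of_int \<lfloor>real (Suc n) * x\<rfloor> / real (Suc n)"
        by (simp add: diff_divide_distrib del: of_nat_Suc)
    qed
    show "\<forall>\<^sub>F n in sequentially. real_of_int \<lfloor>real (Suc n) * x\<rfloor> / real (Suc n) \<le> x"
    proof (rule always_eventually, rule allI)
      fix n
      have "real_of_int \<lfloor>real (Suc n) * x\<rfloor> / real (Suc n) \<le> real (Suc n) * x / real (Suc n)"
        by (rule divide_right_mono) auto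
      then show "real_of_int \<lfloor>real (Suc n) * x\<rfloor> / real (Suc n) \<le> x"
        by (simp del: of_nat_Suc)
    qed
    show "(\<lambda>n. x - 1 / real (Suc n)) \<longlonglongrightarrow> x"
      using tendsto_diff[OF tendsto_const[of x] LIMSEQ_Suc[OF lim_1_over_n]] by simp
  qed simp
  then show "(\<lambda>n. (case z of (\<omega>, x) \<Rightarrow> f \<omega> (real_of_int \<lfloor>real (Suc n) * x\<rfloor> / real (Suc n)))) \<longlonglongrightarrow> (case z of (\<omega>, x) \<Rightarrow> f \<omega> x)"
    using cont[OF z(2)] z(1) continuous_on_tendsto_compose[of UNIV "f \<omega>"] by auto
qed

section \<open>Reduction to finitely many moment conditions\<close>

text \<open>One parameter sets both the number of moments and the tolerance: for fixed
  \<open>K\<close> this is a finite conjunction, yet along \<open>K = n\<close> it forces every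
  moment to converge.\<close>

definition moments_close :: "real measure \<Rightarrow> nat \<Rightarrow> (real \<Rightarrow> real) \<Rightarrow> bool" where
  "moments_close \<mu> K h \<longleftrightarrow>
     (\<forall>l\<le>K. \<bar>(LINT x|lborel. x ^ l * h x) - moment l \<mu>\<bar> \<le> inverse (real (Suc K)))"

lemma moments_close_tendsto:
  assumes "\<And>n. moments_close \<mu> n (h n)"
  shows "(\<lambda>n. LINT x|lborel. x ^ l * h n x) \<longlonglongrightarrow> moment l \<mu>"
proof (rule LIM_zero_cancel, rule Lim_null_comparison)
  show "\<forall>\<^sub>F n in sequentially. norm ((LINT x|lborel. x ^ l * h n x) - moment l \<mu>) \<le> inverse (real (Suc n))"
    using eventually_ge_at_top[of l] by eventually_elim (use assms in \<open>simp add: moments_close_def\<close>)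
qed (rule LIMSEQ_inverse_real_of_nat)

text \<open>If no \<open>K\<close> worked, counterexamples for all \<open>K\<close> would have
  converging moments, and a subsequence would converge uniformly to a continuous density of
  \<open>\<mu>\<close>, which can only be \<open>g\<close>. The resulting \<open>K\<close> serves
  all admissible \<open>h\<close> at once.\<close>

lemma lipschitz_moments_close_imp_near:
  fixes g :: "real \<Rightarrow> real"
  assumes "C > 0" and det: "determined_by_moments \<mu>"
    and g: "C-lipschitz_on UNIV g" "\<And>x. 0 \<le> g x" "\<mu> = density lborel (\<lambda>x. ennreal (g x))"
    and "\<epsilon> > 0"
  obtains K where "\<And>h. C-lipschitz_on UNIV h \<Longrightarrow> (\<And>x. 0 \<le> h x) \<Longrightarrow>
    (\<And>l. integrable lborel (\<lambda>x. x ^ l * h x)) \<Longrightarrow> moments_close \<mu> K h \<Longrightarrow> \<forall>x. \<bar>h x - g x\<bar> < \<epsilon>"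
proof (rule ccontr)
  assume "\<not> thesis"
  then have "\<exists>h. C-lipschitz_on UNIV h \<and> (\<forall>x. 0 \<le> h x) \<and>
      (\<forall>l. integrable lborel (\<lambda>x. x ^ l * h x)) \<and> moments_close \<mu> K h \<and> \<not> (\<forall>x. \<bar>h x - g x\<bar> < \<epsilon>)" for K
    using that by metis
  then obtain h where h: "\<And>n. C-lipschitz_on UNIV (h n)" "\<And>n x. 0 \<le> h n x"
      "\<And>n l. integrable lborel (\<lambda>x. x ^ l * h n x)" "\<And>n. moments_close \<mu> n (h n)"
      "\<And>n. \<not> (\<forall>x. \<bar>h n x - g x\<bar> < \<epsilon>)"
    by metis
  obtain g' r where g': "C-lipschitz_on UNIV g'" "\<And>x. 0 \<le> g' x" "\<mu> = density lborel (\<lambda>x. ennreal (g' x))"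
      and lim: "uniform_limit UNIV (\<lambda>n. h (r n)) g' sequentially"
    by (rule lipschitz_moment_compactness[OF \<open>C > 0\<close> h(1-3) det moments_close_tendsto[OF h(4)]]) (rule that)
  have "g = g'"
    using g g' by (intro continuous_density_unique lipschitz_on_continuous_on) auto
  then have "\<forall>\<^sub>F n in sequentially. \<forall>x. \<bar>h (r n) x - g x\<bar> < \<epsilon>"
    using uniform_limitD[OF lim \<open>\<epsilon> > 0\<close>] by (simp add: dist_real_def)
  then show False using h(5) by (auto dest: eventually_happens)
qed

section \<open>Convergence in probability\<close>

theorem theorem3p15:
  fixes C :: real
    and P :: "nat \<Rightarrow> 'a measure"
    and f :: "nat \<Rightarrow> 'a \<Rightarrow> real \<Rightarrow> real"
    and \<mu> :: "real measure"
  assumes C_pos: "C > 0"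
    and random_lipschitz: "\<And>d. d \<ge> 1 \<Longrightarrow> random_lipschitz_function C (P d) (f d)"
    and finite_moments: "\<And>d \<omega>. d \<ge> 1 \<Longrightarrow> \<omega> \<in> space (P d) \<Longrightarrow>
          density lborel (\<lambda>x. ennreal (f d \<omega> x)) \<in> finite_moment_measures"
    and tails: "\<And>\<epsilon>::real. \<epsilon> > 0 \<Longrightarrow> \<exists>N::real. N > 0 \<and>
          (\<lambda>d. measure (P d) {\<omega> \<in> space (P d). Linf_norm_on (UNIV - {-N..N}) (f d \<omega>) > ereal \<epsilon>})
            \<longlonglongrightarrow> 0"
    and mu: "\<mu> \<in> finite_moment_measures"
    and mu_determined: "determined_by_moments \<mu>"
    and moments: "\<And>(\<epsilon>::real) (l::nat). \<epsilon> > 0 \<Longrightarrow>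
          (\<lambda>d. measure (P d)
             {\<omega> \<in> space (P d). \<bar>(LINT x|lborel. x ^ l * f d \<omega> x) - moment l \<mu>\<bar> > \<epsilon>})
            \<longlonglongrightarrow> 0"
  shows "\<exists>g :: real \<Rightarrow> real.
          (\<forall>x. 0 \<le> g x) \<and>
          (\<forall>\<epsilon>::real. \<epsilon> > 0 \<longrightarrow>
             (\<lambda>d. measure (P d) {\<omega> \<in> space (P d). sup_norm (\<lambda>x. f d \<omega> x - g x) > ereal \<epsilon>})
               \<longlonglongrightarrow> 0) \<and>
          C-lipschitz_on UNIV g \<and>
          \<mu> = density lborel (\<lambda>x. ennreal (g x))"
proof -
  have prob: "prob_space (P d)" if "d \<ge> 1" for d
    using random_lipschitz[OF that] by (simp add: random_lipschitz_function_def)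
  have lip: "C-lipschitz_on UNIV (f d \<omega>)" and nonneg: "0 \<le> f d \<omega> x"
    if "d \<ge> 1" "\<omega> \<in> space (P d)" for d \<omega> x
    using random_lipschitz[OF that(1)] that(2) by (auto simp: random_lipschitz_function_def)
  have cont: "continuous_on UNIV (f d \<omega>)" if "d \<ge> 1" "\<omega> \<in> space (P d)" for d \<omega>
    using lip[OF that] by (rule lipschitz_on_continuous_on)
  have int: "integrable lborel (\<lambda>x. x ^ l * f d \<omega> x)" if "d \<ge> 1" "\<omega> \<in> space (P d)" for d \<omega> l
    using finite_moments[OF that] nonneg[OF that] borel_measurable_continuous_onI[OF cont[OF that]]
    by (simp add: density_finite_moment_measures_iff)
  define A where "A K l d =
    {\<omega> \<in> space (P d). \<bar>(LINT x|lborel. x ^ l * f d \<omega> x) - moment l \<mu>\<bar> > inverse (real (Suc K))}" for K l d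
  \<comment> \<open>A union of \<open>K + 1\<close> events, so the union bound is a finite sum of
    null sequences.\<close>
  define Bad where "Bad K d = (\<Union>l\<le>K. A K l d)" for K d
  have A_sets: "A K l d \<in> sets (P d)" if "d \<ge> 1" for K l d
  proof -
    have "\<And>x. (\<lambda>\<omega>. f d \<omega> x) \<in> borel_measurable (P d)"
      using random_lipschitz[OF that] by (simp add: random_lipschitz_function_def)
    then have [measurable]: "(\<lambda>(\<omega>, x). f d \<omega> x) \<in> borel_measurable (P d \<Otimes>\<^sub>M borel)"
      using cont[OF that] by (rule borel_measurable_caratheodory)
    have "(\<lambda>\<omega>. LINT x|lborel. x ^ l * f d \<omega> x) \<in> borel_measurable (P d)"
      by measurable
    then show ?thesis unfolding A_def by measurable
  qed
  have good: "moments_close \<mu> K (f d \<omega>)" if "\<omega> \<in> space (P d)" "\<omega> \<notin> Bad K d" for K d \<omega>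
    using that by (force simp: Bad_def A_def moments_close_def not_less)
  have Bad_lim: "(\<lambda>d. measure (P d) (Bad K d)) \<longlonglongrightarrow> 0" for K
  proof (rule tendsto_sandwich[where f = "\<lambda>_. 0"])
    show "\<forall>\<^sub>F d in sequentially. measure (P d) (Bad K d) \<le> (\<Sum>l\<le>K. measure (P d) (A K l d))"
      \<comment> \<open>The hypotheses concern \<open>d \<ge> 1\<close>, so the estimates are stated
        for eventually all \<open>d\<close>.\<close>
      using eventually_ge_at_top[of 1]
    proof eventually_elim
      case (elim d)
      interpret prob_space "P d" using prob[OF elim] .
      show ?case unfolding Bad_def
        using A_sets[OF elim] by (intro finite_measure_subadditive_finite) auto
    qed
    show "(\<lambda>d. \<Sum>l\<le>K. measure (P d) (A K l d)) \<longlonglongrightarrow> 0"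
      unfolding A_def by (intro tendsto_null_sum moments) simp
  qed auto
  \<comment> \<open>An event of probability below 1 misses some sample point. Choosing one path for
    each \<open>K\<close> gives a deterministic sequence with converging moments, although the
    sample spaces may differ.\<close>
  have "\<exists>d \<omega>. d \<ge> 1 \<and> \<omega> \<in> space (P d) \<and> moments_close \<mu> K (f d \<omega>)" for K
  proof -
    have "\<forall>\<^sub>F d in sequentially. measure (P d) (Bad K d) < 1"
      using Bad_lim by (rule order_tendstoD) simp
    then have "\<forall>\<^sub>F d in sequentially. d \<ge> 1 \<and> measure (P d) (Bad K d) < 1"
      using eventually_ge_at_top[of 1] by eventually_elim simp
    then obtain d where d: "d \<ge> 1" "measure (P d) (Bad K d) < 1"
      by (auto dest: eventually_happens)
    interpret prob_space "P d" using prob[OF d(1)] .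
    have "Bad K d \<noteq> space (P d)" using d(2) prob_space by auto
    moreover have "Bad K d \<subseteq> space (P d)" by (auto simp: Bad_def A_def)
    ultimately show ?thesis using d(1) good by blast
  qed
  then obtain D W where DW: "\<And>K. D K \<ge> 1" "\<And>K. W K \<in> space (P (D K))"
      "\<And>K. moments_close \<mu> K (f (D K) (W K))"
    by metis
  \<comment> \<open>\<open>g\<close> is fixed here, before any \<open>\<epsilon>\<close>, so the
    same limit serves for every tolerance.\<close>
  obtain g where g: "C-lipschitz_on UNIV g" "\<And>x. 0 \<le> g x"
      "\<mu> = density lborel (\<lambda>x. ennreal (g x))"
    by (rule lipschitz_moment_compactness[OF C_pos lip[OF DW(1,2)] nonneg[OF DW(1,2)]
          int[OF DW(1,2)] mu_determined moments_close_tendsto[OF DW(3)]]) (rule that)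
  have "(\<lambda>d. measure (P d) {\<omega> \<in> space (P d). sup_norm (\<lambda>x. f d \<omega> x - g x) > ereal \<epsilon>}) \<longlonglongrightarrow> 0"
    if "\<epsilon> > 0" for \<epsilon> :: real
  proof -
    obtain K where K: "\<And>h. C-lipschitz_on UNIV h \<Longrightarrow> (\<And>x. 0 \<le> h x) \<Longrightarrow>
        (\<And>l. integrable lborel (\<lambda>x. x ^ l * h x)) \<Longrightarrow> moments_close \<mu> K h \<Longrightarrow> \<forall>x. \<bar>h x - g x\<bar> < \<epsilon>"
      using lipschitz_moments_close_imp_near[OF C_pos mu_determined g \<open>\<epsilon> > 0\<close>] by blast
    show ?thesis
    proof (rule tendsto_sandwich[where f = "\<lambda>_. 0"])
      show "\<forall>\<^sub>F d in sequentially.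
          measure (P d) {\<omega> \<in> space (P d). sup_norm (\<lambda>x. f d \<omega> x - g x) > ereal \<epsilon>} \<le> measure (P d) (Bad K d)"
        using eventually_ge_at_top[of 1]
      proof eventually_elim
        case (elim d)
        interpret prob_space "P d" using prob[OF elim] .
        have "{\<omega> \<in> space (P d). sup_norm (\<lambda>x. f d \<omega> x - g x) > ereal \<epsilon>} \<subseteq> Bad K d"
        proof (rule subsetI, rule ccontr)
          fix \<omega> assume \<omega>: "\<omega> \<in> {\<omega> \<in> space (P d). sup_norm (\<lambda>x. f d \<omega> x - g x) > ereal \<epsilon>}"
            and "\<omega> \<notin> Bad K d"
          then have "\<forall>x. \<bar>f d \<omega> x - g x\<bar> < \<epsilon>"
            using elim by (intro K lip nonneg int good) auto
          \<comment> \<open>Strict pointwise bounds yield only a weak bound on the supremum, which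
            still contradicts the strict inequality in the event.\<close>
          then have "sup_norm (\<lambda>x. f d \<omega> x - g x) \<le> ereal \<epsilon>"
            unfolding sup_norm_def by (intro SUP_least) (simp add: less_imp_le)
          with \<omega> show False by (auto dest: leD)
        qed
        \<comment> \<open>Monotonicity of the measure asks for measurability of the larger
          event.\<close>
        moreover have "Bad K d \<in> events" unfolding Bad_def using A_sets[OF elim] by auto
        ultimately show ?case by (rule finite_measure_mono)
      qed
    qed (use Bad_lim in auto)
  qed
  then show ?thesis using g by blast
qed

end
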